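(* Let $b>1$ be an integer and let $Z$ be the biquandle on $\mathbb{Z}/4\mathbb{Z}$ with $x\,\overline{\triangleright}\,y=3x$ and $x\,\underline{\triangleright}\,y=x+2y$. Let $L$ be an oriented classical link with bridge index $b$ such that $|\mathrm{Hom}(X_L,Z)|=4^b$ (for example, a connected sum of $b-1$ copies of the torus link $T(2,4)$), and let $L'$ be the chain link of $2b-1$ components. Let $\varphi$ be the endomorphism of $Z$ given by $1\mapsto 2$, $2\mapsto 4$, $3\mapsto 2$, $4\mapsto 4$ (where $4\equiv 0$). Then the quiver invariant with respect to $\varphi$ distinguishes $L$ from $L'$; that is, $\mathcal{Q}^{\varphi}_{Z}(L)$ and $\mathcal{Q}^{\varphi}_{Z}(L')$ are not isomorphic as directed graphs.
   Context: For an oriented link diagram $D$ of a link $L$, a semiarc is an edge of $D$ with crossings viewed as 4-valent vertices. For a biquandle $Y$ with operations $\overline{\triangleright},\underline{\triangleright}$, a $Y$-coloring of $D$ is a labeling of semiarcs by elements of $Y$ such that at each crossing, if $x$ labels the under-semiarc lying to the left of the oriented overstrand and $y$ labels the over-semiarc lying to the left of the oriented understrand, then the other under-semiarc is labeled $x\,\underline{\triangleright}\,y$ and the other over-semiarc is labeled $y\,\overline{\triangleright}\,x$. The $Y$-colorings are identified with $\mathrm{Hom}(X_L,Y)$, the biquandle homomorphisms from the fundamental biquandle $X_L$ to $Y$, where $X_L$ is the biquandle generated by the semiarcs of $D$ with the following relations at each crossing: if $x$ is the under-semiarc lying to the left of the oriented overstrand and $y$ is the over-semiarc lying to the left of the oriented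 understrand, then the other under-semiarc equals $x\,\underline{\triangleright}\,y$ and the other over-semiarc equals $y\,\overline{\triangleright}\,x$. For an endomorphism $\varphi$ of $Y$, the biquandle coloring quiver $\mathcal{Q}^{\varphi}_Y(L)$ is the directed graph with vertex set $\mathrm{Hom}(X_L,Y)$ and one edge from each vertex $v$ to $\varphi\circ v$. The chain link of $N=2b-1\ge 3$ components is the link with the following diagram: circles $C_1,\dots,C_N$ arranged cyclically in the plane around a central region, with $C_k$ meeting only $C_{k-1}$ and $C_{k+1}$ (indices mod $N$), and consecutive circles $C_k,C_{k+1}$ crossing at exactly two points, an outer one (away from the central region) and an inner one (adjacent to the central region); at the outer crossing $C_k$ passes over $C_{k+1}$, and at the inner crossing $C_{k+1}$ passes over $C_k$. (Equivalently, up to mirror image, the pretzel link $P(2,\dots,2)$ with $N$ columns.) It is given some fixed orientation. *)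

theory Defs
  imports
    "HOL-Library.FuncSet"
    "HOL-Library.Numeral_Type"
    "Graph_Theory.Digraph_Isomorphism"
begin

section \<open>Oriented link diagrams\<close>

text \<open>
  A link diagram is recorded combinatorially, in the style of a planar diagram code.  A crossing
  consists of its sign and of its two oriented strands; a strand is the pair (incoming semiarc,
  outgoing semiarc).  At a positive crossing the counterclockwise order of the semiarcs is
  under-in, over-out, under-out, over-in; at a negative one it is under-in, over-in, under-out,
  over-out.  A semiarc that meets no crossing is a crossingless circle.
\<close>

datatype 'a crossing = Crossing (positive: bool) (under: "'a \<times> 'a") (over: "'a \<times> 'a")

record diagram =
  semiarcs :: "nat set"
  crossings :: "nat crossing set"

definition strands :: "nat crossing set \<Rightarrow> (nat \<times> nat) set" where
  "strands C = under ` C \<union> over ` C"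

text \<open>The Boolean tells the overstrand (True) of a crossing from its understrand (False).\<close>

definition passage :: "nat crossing \<times> bool \<Rightarrow> nat \<times> nat" where
  "passage p = (if snd p then over (fst p) else under (fst p))"

definition well_formed :: "diagram \<Rightarrow> bool" where
  "well_formed D \<longleftrightarrow>
     finite (semiarcs D) \<and> finite (crossings D) \<and>
     inj_on (fst \<circ> passage) (crossings D \<times> UNIV) \<and>
     inj_on (snd \<circ> passage) (crossings D \<times> UNIV) \<and>
     fst ` strands (crossings D) = snd ` strands (crossings D) \<and>
     fst ` strands (crossings D) \<subseteq> semiarcs D"

text \<open>The classes of the equivalence relation on \<open>A\<close> generated by a relation \<open>R \<subseteq> A \<times> A\<close>.\<close>

definition classes :: "'a set \<Rightarrow> ('a \<times> 'a) set \<Rightarrow> 'a set set" where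
  "classes A R = A // (R \<union> R\<inverse>)\<^sup>*"

definition components :: "diagram \<Rightarrow> nat set set" where
  "components D = classes (semiarcs D) (strands (crossings D))"

text \<open>
  A diagram is planar iff its faces satisfy Euler's formula on every connected piece.  Every semiarc
  has a left and a right side, and each of the four corners of a crossing joins two sides that belong
  to the same face.  With \<open>V\<close> crossings and \<open>K\<close> connected pieces, the 4-valent graph has \<open>2 * V\<close> edges,
  so genus 0 on every piece means that there are \<open>V + 2 * K\<close> faces in total.  A crossingless circle
  counts as one connected piece with two faces.
\<close>

datatype side = Lft | Rgt

fun corners :: "'a crossing \<Rightarrow> (('a \<times> side) \<times> ('a \<times> side)) set" where
  "corners (Crossing True (a, b) (c, d)) =
     {((a, Rgt), (d, Rgt)), ((d, Lft), (b, Rgt)), ((b, Lft), (c, Lft)), ((c, Rgt), (a, Lft))}"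
| "corners (Crossing False (a, b) (c, d)) =
     {((a, Rgt), (c, Lft)), ((c, Rgt), (b, Rgt)), ((b, Lft), (d, Rgt)), ((d, Lft), (a, Lft))}"

definition faces :: "diagram \<Rightarrow> (nat \<times> side) set set" where
  "faces D = classes (semiarcs D \<times> {Lft, Rgt}) (\<Union>c\<in>crossings D. corners c)"

definition pieces :: "diagram \<Rightarrow> nat set set" where
  "pieces D = classes (semiarcs D) (\<Union>c\<in>crossings D. set_crossing c \<times> set_crossing c)"

definition planar :: "diagram \<Rightarrow> bool" where
  "planar D \<longleftrightarrow> card (faces D) = card (crossings D) + 2 * card (pieces D)"

definition classical_diagram :: "diagram \<Rightarrow> bool" where
  "classical_diagram D \<longleftrightarrow> well_formed D \<and> planar D"


section \<open>Reidemeister moves, links and the bridge index\<close>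

text \<open>
  \<open>erases S D D'\<close>: up to a relabelling of semiarcs, \<open>D'\<close> arises from \<open>D\<close> by deleting the crossings in
  \<open>S\<close> and merging, for each of their strands, the incoming semiarc with the outgoing one.
  For empty \<open>S\<close> this is a mere relabelling.
\<close>

definition erases :: "nat crossing set \<Rightarrow> diagram \<Rightarrow> diagram \<Rightarrow> bool" where
  "erases S D D' \<longleftrightarrow>
     (\<exists>r. semiarcs D' = r ` semiarcs D \<and>
          crossings D' = map_crossing r ` (crossings D - S) \<and>
          (\<forall>x\<in>semiarcs D. \<forall>y\<in>semiarcs D.
             r x = r y \<longleftrightarrow> (x, y) \<in> (strands S \<union> (strands S)\<inverse>)\<^sup>*))"

text \<open>\<open>joined p q x\<close>: the strands \<open>p\<close> and \<open>q\<close> are consecutive, in either order, with \<open>x\<close> in between.\<close>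

definition joined :: "nat \<times> nat \<Rightarrow> nat \<times> nat \<Rightarrow> nat \<Rightarrow> bool" where
  "joined p q x \<longleftrightarrow> (snd p = x \<and> fst q = x) \<or> (snd q = x \<and> fst p = x)"

text \<open>
  In the second move the bigon between the two crossings is a face exactly because the signs are
  opposite.  In the third move the top strand runs over the middle strand at \<open>c1\<close> and over the bottom
  strand at \<open>c2\<close>, and the middle strand runs over the bottom strand at \<open>c3\<close>; the last three premises
  say that the semiarcs \<open>x\<close>, \<open>y\<close>, \<open>z\<close> bound a triangular face.  After the move each of the three
  strands meets its two crossings in the opposite order: the two (in, out) pairs of that strand are
  exchanged, and the signs are kept.
\<close>

inductive reidemeister :: "diagram \<Rightarrow> diagram \<Rightarrow> bool" where
  relabel: "erases {} D D' \<Longrightarrow> reidemeister D D'"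
| R1: "\<lbrakk>c \<in> crossings D;
        snd (under c) = fst (over c) \<or> snd (over c) = fst (under c);
        erases {c} D D'\<rbrakk> \<Longrightarrow> reidemeister D D'"
| R2: "\<lbrakk>c1 \<in> crossings D; c2 \<in> crossings D; positive c1 \<noteq> positive c2;
        joined (over c1) (over c2) x; joined (under c1) (under c2) y;
        erases {c1, c2} D D'\<rbrakk> \<Longrightarrow> reidemeister D D'"
| R3: "\<lbrakk>c1 \<in> crossings D; c2 \<in> crossings D; c3 \<in> crossings D;
        c1 \<noteq> c2; c1 \<noteq> c3; c2 \<noteq> c3;
        joined (over c1) (over c2) x; joined (under c1) (over c3) y;
        joined (under c2) (under c3) z;
        ((x, s), (y, t)) \<in> corners c1 \<union> (corners c1)\<inverse>;
        ((x, s), (z, u)) \<in> corners c2 \<union> (corners c2)\<inverse>;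
        ((y, t), (z, u)) \<in> corners c3 \<union> (corners c3)\<inverse>;
        semiarcs D' = semiarcs D;
        crossings D' = (crossings D - {c1, c2, c3}) \<union>
          {Crossing (positive c1) (over c3) (over c2),
           Crossing (positive c2) (under c3) (over c1),
           Crossing (positive c3) (under c2) (under c1)}\<rbrakk> \<Longrightarrow> reidemeister D D'"

definition link_equiv :: "diagram \<Rightarrow> diagram \<Rightarrow> bool" where
  "link_equiv =
     equivclp (\<lambda>D D'. classical_diagram D \<and> classical_diagram D' \<and> reidemeister D D')"

text \<open>A link is identified with the set of its diagrams.\<close>

definition link_of :: "diagram \<Rightarrow> diagram set" where
  "link_of D = {D'. link_equiv D D'}"

definition oriented_classical_links :: "diagram set set" where
  "oriented_classical_links = {link_of D | D. classical_diagram D}"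

text \<open>
  The bridges (maximal overpasses) of a diagram correspond to the semiarcs that leave an
  undercrossing and end in an overcrossing.  A component without such a semiarc (a crossingless
  circle, or one that runs only over or only under) is counted as one bridge.
\<close>

definition bridge_starts :: "diagram \<Rightarrow> nat set" where
  "bridge_starts D = snd ` under ` crossings D \<inter> fst ` over ` crossings D"

definition bridge_number :: "diagram \<Rightarrow> nat" where
  "bridge_number D =
     card (bridge_starts D) + card {K \<in> components D. K \<inter> bridge_starts D = {}}"

definition bridge_index :: "diagram set \<Rightarrow> nat" where
  "bridge_index L = (LEAST n. \<exists>D\<in>L. bridge_number D = n)"


section \<open>Biquandles\<close>

record 'a biquandle =
  carrier :: "'a set"
  un :: "'a \<Rightarrow> 'a \<Rightarrow> 'a"  \<comment> \<open>the operation written as an underlined triangle\<close>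
  ov :: "'a \<Rightarrow> 'a \<Rightarrow> 'a"  \<comment> \<open>the operation written as an overlined triangle\<close>

definition is_biquandle :: "'a biquandle \<Rightarrow> bool" where
  "is_biquandle Y \<longleftrightarrow>
     (\<forall>x\<in>carrier Y. un Y x x = ov Y x x) \<and>
     (\<forall>y\<in>carrier Y. bij_betw (\<lambda>x. un Y x y) (carrier Y) (carrier Y)) \<and>
     (\<forall>y\<in>carrier Y. bij_betw (\<lambda>x. ov Y x y) (carrier Y) (carrier Y)) \<and>
     bij_betw (\<lambda>(x, y). (ov Y y x, un Y x y)) (carrier Y \<times> carrier Y) (carrier Y \<times> carrier Y) \<and>
     (\<forall>x\<in>carrier Y. \<forall>y\<in>carrier Y. \<forall>z\<in>carrier Y.
        un Y (un Y x y) (un Y z y) = un Y (un Y x z) (ov Y y z) \<and>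
        ov Y (un Y x y) (un Y z y) = un Y (ov Y x z) (ov Y y z) \<and>
        ov Y (ov Y x y) (ov Y z y) = ov Y (ov Y x z) (un Y y z))"

definition biquandle_hom :: "'a biquandle \<Rightarrow> 'b biquandle \<Rightarrow> ('a \<Rightarrow> 'b) set" where
  "biquandle_hom X Y =
     {f \<in> carrier X \<rightarrow>\<^sub>E carrier Y.
        \<forall>x\<in>carrier X. \<forall>y\<in>carrier X.
          f (un X x y) = un Y (f x) (f y) \<and> f (ov X x y) = ov Y (f x) (f y)}"


section \<open>The fundamental biquandle\<close>

text \<open>
  Biquandle words.  \<open>UnInv\<close> and \<open>OvInv\<close> stand for the inverses of the right translations, and
  \<open>SwapL\<close>, \<open>SwapR\<close> for the two components of the inverse of the map sending \<open>(x, y)\<close> to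
  \<open>(ov y x, un x y)\<close>, so that the biquandle axioms become equations.
\<close>

datatype 'g bq_word =
  Gen 'g
| UnOp "'g bq_word" "'g bq_word"
| OvOp "'g bq_word" "'g bq_word"
| UnInv "'g bq_word" "'g bq_word"
| OvInv "'g bq_word" "'g bq_word"
| SwapL "'g bq_word" "'g bq_word"
| SwapR "'g bq_word" "'g bq_word"

inductive_set bq_axioms :: "('g bq_word \<times> 'g bq_word) set" where
  "(UnOp x x, OvOp x x) \<in> bq_axioms"
| "(UnOp (UnInv x y) y, x) \<in> bq_axioms"
| "(UnInv (UnOp x y) y, x) \<in> bq_axioms"
| "(OvOp (OvInv x y) y, x) \<in> bq_axioms"
| "(OvInv (OvOp x y) y, x) \<in> bq_axioms"
| "(OvOp (SwapR x y) (SwapL x y), x) \<in> bq_axioms"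
| "(UnOp (SwapL x y) (SwapR x y), y) \<in> bq_axioms"
| "(SwapL (OvOp y x) (UnOp x y), x) \<in> bq_axioms"
| "(SwapR (OvOp y x) (UnOp x y), y) \<in> bq_axioms"
| "(UnOp (UnOp x y) (UnOp z y), UnOp (UnOp x z) (OvOp y z)) \<in> bq_axioms"
| "(OvOp (UnOp x y) (UnOp z y), UnOp (OvOp x z) (OvOp y z)) \<in> bq_axioms"
| "(OvOp (OvOp x y) (OvOp z y), OvOp (OvOp x z) (UnOp y z)) \<in> bq_axioms"

definition bq_words :: "'g set \<Rightarrow> 'g bq_word set" where
  "bq_words A = {w. set_bq_word w \<subseteq> A}"

text \<open>The congruence on the words over \<open>A\<close> generated by the biquandle axioms and the relations \<open>R\<close>.\<close>

inductive_set bq_cong :: "'g set \<Rightarrow> ('g bq_word \<times> 'g bq_word) set \<Rightarrow> ('g bq_word \<times> 'g bq_word) set"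
  for A R where
  base: "\<lbrakk>(s, t) \<in> bq_axioms \<union> R; s \<in> bq_words A; t \<in> bq_words A\<rbrakk> \<Longrightarrow> (s, t) \<in> bq_cong A R"
| refl: "t \<in> bq_words A \<Longrightarrow> (t, t) \<in> bq_cong A R"
| sym: "(s, t) \<in> bq_cong A R \<Longrightarrow> (t, s) \<in> bq_cong A R"
| trans: "\<lbrakk>(s, t) \<in> bq_cong A R; (t, u) \<in> bq_cong A R\<rbrakk> \<Longrightarrow> (s, u) \<in> bq_cong A R"
| cong: "\<lbrakk>(s, s') \<in> bq_cong A R; (t, t') \<in> bq_cong A R; F \<in> {UnOp, OvOp, UnInv, OvInv, SwapL, SwapR}\<rbrakk>
          \<Longrightarrow> (F s t, F s' t') \<in> bq_cong A R"

definition presented_biquandle ::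
    "'g set \<Rightarrow> ('g bq_word \<times> 'g bq_word) set \<Rightarrow> 'g bq_word set biquandle" where
  "presented_biquandle A R =
     \<lparr>carrier = bq_words A // bq_cong A R,
      un = \<lambda>P Q. \<Union>s\<in>P. \<Union>t\<in>Q. bq_cong A R `` {UnOp s t},
      ov = \<lambda>P Q. \<Union>s\<in>P. \<Union>t\<in>Q. bq_cong A R `` {OvOp s t}\<rparr>"

lemma bq_cong_equiv: "equiv (bq_words A) (bq_cong A R)"
proof (rule equivI)
  have "s \<in> bq_words A \<and> t \<in> bq_words A" if "(s, t) \<in> bq_cong A R" for s t
    using that by induction (auto simp: bq_words_def)
  then show "bq_cong A R \<subseteq> bq_words A \<times> bq_words A" by auto
qed (auto intro!: refl_onI symI transI intro: bq_cong.refl bq_cong.sym bq_cong.trans)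

lemma presented_biquandle: "is_biquandle (presented_biquandle A R)"
proof -
  let ?W = "bq_words A" and ?E = "bq_cong A R" and ?X = "presented_biquandle A R"
  define cl where "cl w = ?E `` {w}" for w
  define op where "op F P Q = (\<Union>s\<in>P. \<Union>t\<in>Q. ?E `` {F s t})"
    for F :: "'a bq_word \<Rightarrow> 'a bq_word \<Rightarrow> 'a bq_word" and P Q
  let ?Ops = "{UnOp, OvOp, UnInv, OvInv, SwapL, SwapR}"
  note E = bq_cong_equiv[of A R]
  have closed: "F s t \<in> ?W" if "F \<in> ?Ops" "s \<in> ?W" "t \<in> ?W" for F s t
    using that by (auto simp: bq_words_def)
  have op: "op F (cl s) (cl t) = cl (F s t)" if "F \<in> ?Ops" "s \<in> ?W" "t \<in> ?W" for F s t
  proof -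
    have "congruent2 ?E ?E (\<lambda>s t. ?E `` {F s t})"
      using that(1) by (intro congruent2I' equiv_class_eq[OF E]) (auto intro: bq_cong.cong)
    from UN_equiv_class2[OF E E this that(2,3)] show ?thesis
      by (simp add: op_def cl_def)
  qed
  have ax: "cl s = cl t" if "(s, t) \<in> bq_axioms" "s \<in> ?W" "t \<in> ?W" for s t
    unfolding cl_def using that by (intro equiv_class_eq[OF E]) (auto intro: bq_cong.base)
  have carrier: "carrier ?X = cl ` ?W"
    by (auto simp: presented_biquandle_def cl_def quotient_def)
  have ops: "un ?X = op UnOp" "ov ?X = op OvOp"
    by (auto simp: presented_biquandle_def op_def fun_eq_iff)
  have mem: "op F P Q \<in> carrier ?X" if "F \<in> ?Ops" "P \<in> carrier ?X" "Q \<in> carrier ?X" for F P Q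
    using that op closed by (auto simp: carrier)
  note [simp] = op closed
  have lift: "un ?X P P = ov ?X P P"
    "op UnOp (op UnInv P Q) Q = P" "op UnInv (op UnOp P Q) Q = P"
    "op OvOp (op OvInv P Q) Q = P" "op OvInv (op OvOp P Q) Q = P"
    "op OvOp (op SwapR P Q) (op SwapL P Q) = P" "op UnOp (op SwapL P Q) (op SwapR P Q) = Q"
    "op SwapL (op OvOp Q P) (op UnOp P Q) = P" "op SwapR (op OvOp Q P) (op UnOp P Q) = Q"
    "un ?X (un ?X P Q) (un ?X S Q) = un ?X (un ?X P S) (ov ?X Q S)"
    "ov ?X (un ?X P Q) (un ?X S Q) = un ?X (ov ?X P S) (ov ?X Q S)"
    "ov ?X (ov ?X P Q) (ov ?X S Q) = ov ?X (ov ?X P S) (un ?X Q S)"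
    if PQS: "P \<in> carrier ?X" "Q \<in> carrier ?X" "S \<in> carrier ?X" for P Q S
  proof -
    obtain p q s where "p \<in> ?W" "q \<in> ?W" "s \<in> ?W" "P = cl p" "Q = cl q" "S = cl s"
      using PQS by (auto simp: carrier)
    then show "un ?X P P = ov ?X P P"
      "op UnOp (op UnInv P Q) Q = P" "op UnInv (op UnOp P Q) Q = P"
      "op OvOp (op OvInv P Q) Q = P" "op OvInv (op OvOp P Q) Q = P"
      "op OvOp (op SwapR P Q) (op SwapL P Q) = P" "op UnOp (op SwapL P Q) (op SwapR P Q) = Q"
      "op SwapL (op OvOp Q P) (op UnOp P Q) = P" "op SwapR (op OvOp Q P) (op UnOp P Q) = Q"
      "un ?X (un ?X P Q) (un ?X S Q) = un ?X (un ?X P S) (ov ?X Q S)"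
      "ov ?X (un ?X P Q) (un ?X S Q) = un ?X (ov ?X P S) (ov ?X Q S)"
      "ov ?X (ov ?X P Q) (ov ?X S Q) = ov ?X (ov ?X P S) (un ?X Q S)"
      by (simp_all add: ops ax bq_axioms.intros)
  qed
  have "bij_betw (\<lambda>x. un ?X x y) (carrier ?X) (carrier ?X)" if "y \<in> carrier ?X" for y
    using that lift mem
    by (intro bij_betw_byWitness[where f' = "\<lambda>x. op UnInv x y"]) (auto simp: ops)
  moreover have "bij_betw (\<lambda>x. ov ?X x y) (carrier ?X) (carrier ?X)" if "y \<in> carrier ?X" for y
    using that lift mem
    by (intro bij_betw_byWitness[where f' = "\<lambda>x. op OvInv x y"]) (auto simp: ops)
  moreover have "bij_betw (\<lambda>(x, y). (ov ?X y x, un ?X x y))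
      (carrier ?X \<times> carrier ?X) (carrier ?X \<times> carrier ?X)"
    using lift mem
    by (intro bij_betw_byWitness[where f' = "\<lambda>(u, v). (op SwapL u v, op SwapR u v)"])
      (auto simp: ops)
  ultimately show ?thesis
    unfolding is_biquandle_def by (intro conjI ballI) (assumption | rule lift | blast)+
qed

text \<open>
  At a positive crossing the under-semiarc to the left of the overstrand is the outgoing one, and
  the over-semiarc to the left of the understrand is the incoming one; at a negative crossing it is
  the other way round.
\<close>

fun crossing_relations :: "'a crossing \<Rightarrow> ('a bq_word \<times> 'a bq_word) set" where
  "crossing_relations (Crossing True (a, b) (c, d)) =
     {(Gen a, UnOp (Gen b) (Gen c)), (Gen d, OvOp (Gen c) (Gen b))}"
| "crossing_relations (Crossing False (a, b) (c, d)) =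
     {(Gen b, UnOp (Gen a) (Gen d)), (Gen c, OvOp (Gen d) (Gen a))}"

definition fundamental_biquandle :: "diagram \<Rightarrow> nat bq_word set biquandle" where
  "fundamental_biquandle D =
     presented_biquandle (semiarcs D) (\<Union>c\<in>crossings D. crossing_relations c)"


section \<open>The biquandle coloring quiver\<close>

text \<open>Each vertex is also used as the name of its unique outgoing edge.\<close>

definition coloring_quiver ::
    "'a biquandle \<Rightarrow> ('a \<Rightarrow> 'a) \<Rightarrow> diagram \<Rightarrow>
       (nat bq_word set \<Rightarrow> 'a, nat bq_word set \<Rightarrow> 'a) pre_digraph" where
  "coloring_quiver Y \<phi> D =
     \<lparr>verts = biquandle_hom (fundamental_biquandle D) Y,
      arcs = biquandle_hom (fundamental_biquandle D) Y,
      tail = (\<lambda>v. v),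
      head = (\<lambda>v. compose (carrier (fundamental_biquandle D)) \<phi> v)\<rparr>"


section \<open>The biquandle on the integers modulo 4\<close>

text \<open>The type \<open>4\<close> is the ring of integers modulo 4; in particular \<open>4 = 0\<close> there.\<close>

definition Z4_biquandle :: "4 biquandle" where
  "Z4_biquandle = \<lparr>carrier = UNIV, un = (\<lambda>x y. x + 2 * y), ov = (\<lambda>x y. 3 * x)\<rparr>"

definition phi :: "4 \<Rightarrow> 4" where
  "phi x = (if x = 1 then 2 else if x = 2 then 4 else if x = 3 then 2 else 4)"

lemma Z4_cases: "(x::4) = 0 \<or> x = 1 \<or> x = 2 \<or> x = 3"
proof (cases x rule: bit0_cases)
  case (of_int z)
  then have "z = 0 \<or> z = 1 \<or> z = 2 \<or> z = 3" by auto
  with of_int show ?thesis by auto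
qed

lemma Z4_mult_numeral:
  fixes x :: 4
  shows "x * 4 = 0" "x * 8 = 0" "x * 9 = x" "x * 6 = x * 2" "x * 16 = 0"
    "4 * x = 0" "8 * x = 0" "9 * x = x" "6 * x = 2 * x" "16 * x = 0"
  using Z4_cases[of x] by auto

lemma Z4_biquandle: "is_biquandle Z4_biquandle"
proof -
  have un: "bij (\<lambda>x::4. x + 2 * y)" for y
    by (rule o_bij[of "\<lambda>x. x - 2 * y"]) auto
  have ov: "bij (\<lambda>x::4. 3 * x)"
    by (rule o_bij[of "\<lambda>x. 3 * x"]) (auto simp: fun_eq_iff Z4_mult_numeral)
  have S: "bij (\<lambda>(x, y). (3 * y, x + 2 * y) :: 4 \<times> 4)"
    by (rule o_bij[of "\<lambda>(u, v). (v - 2 * (3 * u), 3 * u)"])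
      (auto simp: fun_eq_iff Z4_mult_numeral algebra_simps)
  have triple: "3 * (x::4) = x + 2 * x" for x
    by (simp add: algebra_simps)
  show ?thesis
    using un ov S
    by (auto simp: is_biquandle_def Z4_biquandle_def triple Z4_mult_numeral algebra_simps)
qed

lemma phi_endomorphism: "phi \<in> biquandle_hom Z4_biquandle Z4_biquandle"
proof -
  have phi: "phi x = 2 * x" for x
    using Z4_cases[of x] by (auto simp: phi_def)
  show ?thesis
    by (auto simp: biquandle_hom_def Z4_biquandle_def phi Z4_mult_numeral algebra_simps)
qed


section \<open>Chain links\<close>

text \<open>
  The circles \<open>0, ..., N - 1\<close> are arranged around the central region, counterclockwise if \<open>ccw\<close> holds
  and clockwise (which gives the mirror image) otherwise.  Following the circle \<open>k\<close> in the sense of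
  the arrangement, one meets the outer crossing with \<open>k - 1\<close> (under), the outer crossing with \<open>k + 1\<close>
  (over), the inner crossing with \<open>k + 1\<close> (under) and the inner crossing with \<open>k - 1\<close> (over);
  the semiarc that follows the \<open>j\<close>-th of these crossings (\<open>j = 0, ..., 3\<close>) is \<open>4 * k + j\<close>.
  The circle \<open>k\<close> is oriented in that sense if \<open>ort k\<close> holds and oppositely otherwise.  For \<open>ccw\<close>,
  both crossings of two neighbouring circles oriented in the same sense are negative.
\<close>

definition chain_strand :: "(nat \<Rightarrow> bool) \<Rightarrow> nat \<Rightarrow> nat \<Rightarrow> nat \<Rightarrow> nat \<times> nat" where
  "chain_strand ort k i j = (if ort k then (4 * k + i, 4 * k + j) else (4 * k + j, 4 * k + i))"

definition chain_sign :: "bool \<Rightarrow> (nat \<Rightarrow> bool) \<Rightarrow> nat \<Rightarrow> nat \<Rightarrow> bool" where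
  "chain_sign ccw ort k l \<longleftrightarrow> (if ccw then ort k \<noteq> ort l else ort k = ort l)"

definition outer_crossing :: "bool \<Rightarrow> (nat \<Rightarrow> bool) \<Rightarrow> nat \<Rightarrow> nat \<Rightarrow> nat crossing" where
  "outer_crossing ccw ort k l =
     Crossing (chain_sign ccw ort k l) (chain_strand ort l 3 0) (chain_strand ort k 0 1)"

definition inner_crossing :: "bool \<Rightarrow> (nat \<Rightarrow> bool) \<Rightarrow> nat \<Rightarrow> nat \<Rightarrow> nat crossing" where
  "inner_crossing ccw ort k l =
     Crossing (chain_sign ccw ort k l) (chain_strand ort k 1 2) (chain_strand ort l 2 3)"

definition chain_diagram :: "nat \<Rightarrow> bool \<Rightarrow> (nat \<Rightarrow> bool) \<Rightarrow> diagram" where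
  "chain_diagram N ccw ort =
     \<lparr>semiarcs = {..<4 * N},
      crossings = (\<Union>k<N. {outer_crossing ccw ort k (Suc k mod N),
                           inner_crossing ccw ort k (Suc k mod N)})\<rparr>"

definition chain_link :: "nat \<Rightarrow> bool \<Rightarrow> (nat \<Rightarrow> bool) \<Rightarrow> diagram set" where
  "chain_link N ccw ort = link_of (chain_diagram N ccw ort)"

end

theory Submission
  imports Defs
begin

text \<open>
  The endomorphism is \<open>x \<mapsto> 2 * x\<close>, and both operations of the biquandle on the integers modulo 4 are
  linear.  The colorings of a diagram are therefore closed under pointwise addition and
  subtraction, and the quiver joins each coloring \<open>v\<close> to \<open>2 * v\<close>.  Two colorings have the same
  double iff they differ by a coloring of double zero, so all vertices with an incoming edge have
  the same in-degree, the order of the kernel of doubling (\<open>card_doubling_fibre\<close>).  This order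
  is thus determined by the isomorphism type of the quiver (\<open>card_doubling_kernel_eq_if_iso\<close>).

  The kernel consists of the colorings with values 0 and 2.  On these values both operations
  return their first argument, so such a coloring is an arbitrary choice of 0 or 2 on each
  component, and the kernel has \<open>2 ^ c\<close> elements for a diagram with \<open>c\<close> components
  (\<open>card_doubling_kernel\<close>).  Passing from homomorphisms on the fundamental biquandle to labels of
  the semiarcs is the universal property of a presentation (\<open>presented_biquandle_universal\<close>).

  It remains to compare numbers of components, which Reidemeister moves preserve
  (\<open>card_components_link_equiv\<close>).  Every component contributes to the bridge number of a
  diagram, so a link of bridge index \<open>b\<close> has at most \<open>b\<close> components
  (\<open>card_components_le_bridge_index\<close>), whereas the chain link has at least \<open>2 * b - 1\<close>, which
  is larger when \<open>b > 1\<close>.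
\<close>


section \<open>Counting classes of a generated equivalence relation\<close>

lemma equiv_generated: "equiv UNIV ((R \<union> R\<inverse>)\<^sup>*)"
  by (intro equivI refl_rtrancl trans_rtrancl sym_rtrancl)
    (auto simp: sym_Un_converse)

lemma classes_eq_image: "classes A R = (\<lambda>x. (R \<union> R\<inverse>)\<^sup>* `` {x}) ` A"
  by (auto simp: classes_def quotient_def)

lemma class_eq_iff:
  "(R \<union> R\<inverse>)\<^sup>* `` {x} = (R \<union> R\<inverse>)\<^sup>* `` {y} \<longleftrightarrow> (x, y) \<in> (R \<union> R\<inverse>)\<^sup>*"
  by (rule eq_equiv_class_iff[OF equiv_generated]) auto

lemma constant_on_class:
  assumes "\<And>a b. (a, b) \<in> R \<Longrightarrow> g a = g b" and "(x, y) \<in> (R \<union> R\<inverse>)\<^sup>*"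
  shows "g x = g y"
  using assms(2) by induction (auto dest: assms(1))

lemma card_image_eq_if_same_kernel:
  assumes "\<And>x y. x \<in> A \<Longrightarrow> y \<in> A \<Longrightarrow> f x = f y \<longleftrightarrow> g x = g y"
  shows "card (f ` A) = card (g ` A)"
proof (rule bij_betw_same_card)
  have "g (inv_into A f (f x)) = g x" if "x \<in> A" for x
    using assms[of "inv_into A f (f x)" x] that
    by (auto simp: inv_into_into f_inv_into_f)
  then show "bij_betw (\<lambda>z. g (inv_into A f z)) (f ` A) (g ` A)"
    by (auto simp: bij_betw_def inj_on_def image_image assms)
qed

text \<open>
  A function that is constant along \<open>R\<close> factors through the classes; this bounds the number of
  classes from below without determining them.
\<close>

lemma card_image_le_card_classes:
  assumes "finite A" and "\<And>a b. (a, b) \<in> R \<Longrightarrow> g a = g b"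
  shows "card (g ` A) \<le> card (classes A R)"
proof (rule surj_card_le)
  show "finite (classes A R)"
    using assms(1) by (simp add: classes_eq_image)
  show "g ` A \<subseteq> (\<lambda>K. g (SOME x. x \<in> K)) ` classes A R"
  proof
    fix z assume "z \<in> g ` A"
    then obtain x where x: "x \<in> A" "z = g x" by auto
    let ?K = "(R \<union> R\<inverse>)\<^sup>* `` {x}"
    have "(SOME y. y \<in> ?K) \<in> ?K" by (rule someI[of _ x]) auto
    then have "g x = g (SOME y. y \<in> ?K)"
      using constant_on_class[of R g x] assms(2) by simp
    with x show "z \<in> (\<lambda>K. g (SOME x. x \<in> K)) ` classes A R"
      unfolding classes_eq_image image_image by (metis (no_types, lifting) image_eqI)
  qed
qed

text \<open>
  Restriction to representatives identifies the functions constant along \<open>R\<close> with the functions on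
  the classes.  The inclusion \<open>R \<subseteq> A \<times> A\<close> keeps \<open>R\<close> away from the points outside \<open>A\<close>, where an
  extensional function has the default value.
\<close>

lemma card_functions_constant_along:
  assumes "finite A" and R: "R \<subseteq> A \<times> A"
  shows "card {g \<in> A \<rightarrow>\<^sub>E T. \<forall>(a, b)\<in>R. g a = g b} = card T ^ card (classes A R)"
proof -
  define cl where "cl x = (R \<union> R\<inverse>)\<^sup>* `` {x}" for x
  have classes: "classes A R = cl ` A"
    by (simp add: classes_eq_image cl_def)
  have cl_R: "cl a = cl b" if "(a, b) \<in> R" for a b
    using that unfolding cl_def class_eq_iff by auto
  let ?F = "\<lambda>h. \<lambda>x\<in>A. h (cl x)"
  have "bij_betw ?F (classes A R \<rightarrow>\<^sub>E T) {g \<in> A \<rightarrow>\<^sub>E T. \<forall>(a, b)\<in>R. g a = g b}"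
  proof (rule bij_betw_imageI)
    show "inj_on ?F (classes A R \<rightarrow>\<^sub>E T)"
    proof (rule inj_onI)
      fix h h' assume h: "h \<in> classes A R \<rightarrow>\<^sub>E T" "h' \<in> classes A R \<rightarrow>\<^sub>E T" and "?F h = ?F h'"
      then have "h (cl x) = h' (cl x)" if "x \<in> A" for x
        using that by (metis restrict_apply')
      with h show "h = h'"
        by (intro PiE_ext[OF h]) (auto simp: classes)
    qed
    show "?F ` (classes A R \<rightarrow>\<^sub>E T) = {g \<in> A \<rightarrow>\<^sub>E T. \<forall>(a, b)\<in>R. g a = g b}" (is "?L = ?G")
    proof (intro equalityI subsetI)
      fix g assume "g \<in> ?L"
      then obtain h where "h \<in> classes A R \<rightarrow>\<^sub>E T" "g = ?F h" by auto
      then show "g \<in> ?G"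
        using cl_R subsetD[OF R] by (fastforce simp: classes)
    next
      fix g assume g: "g \<in> ?G"
      let ?h = "\<lambda>K\<in>classes A R. g (SOME x. x \<in> K)"
      have eq: "g (SOME y. y \<in> cl x) = g x" for x
      proof -
        have "(SOME y. y \<in> cl x) \<in> cl x" by (rule someI[of _ x]) (auto simp: cl_def)
        then have "(x, SOME y. y \<in> cl x) \<in> (R \<union> R\<inverse>)\<^sup>*" by (simp add: cl_def)
        then show ?thesis
          using g constant_on_class[of R g x] by fastforce
      qed
      have "?F ?h = g"
        using g by (intro ext) (auto simp: classes eq PiE_def extensional_def)
      moreover have "?h \<in> classes A R \<rightarrow>\<^sub>E T"
        using g by (auto simp: classes eq)
      ultimately show "g \<in> ?L" by (rule rev_image_eqI[rotated, OF HOL.sym])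
    qed
  qed
  then have "card {g \<in> A \<rightarrow>\<^sub>E T. \<forall>(a, b)\<in>R. g a = g b} = card (classes A R \<rightarrow>\<^sub>E T)"
    by (rule bij_betw_same_card[symmetric])
  also have "\<dots> = card T ^ card (classes A R)"
    using assms(1) by (simp add: card_funcsetE classes)
  finally show ?thesis .
qed


section \<open>The number of components is a link invariant\<close>

lemma well_formed_strands_subset:
  assumes "well_formed D"
  shows "strands (crossings D) \<subseteq> semiarcs D \<times> semiarcs D"
proof -
  have "fst ` strands (crossings D) \<subseteq> semiarcs D" "snd ` strands (crossings D) \<subseteq> semiarcs D"
    using assms by (auto simp: well_formed_def)
  then show ?thesis by force
qed

lemma strands_map_crossing:
  "strands (map_crossing r ` C) = map_prod r r ` strands C"
  by (auto simp: strands_def image_image image_Un crossing.map_sel)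

text \<open>
  The relation \<open>R\<close> plays the strands of a diagram, \<open>S\<close> those of the erased crossings and \<open>Q\<close> those of
  the new diagram.  A strand of \<open>S\<close> is contracted to a point by \<open>r\<close>, and every fibre of \<open>r\<close> is
  connected by strands of \<open>S\<close>, so paths can be pushed forward and lifted.
\<close>

lemma erases_connected_iff:
  assumes r: "\<And>x y. x \<in> A \<Longrightarrow> y \<in> A \<Longrightarrow> r x = r y \<longleftrightarrow> (x, y) \<in> (S \<union> S\<inverse>)\<^sup>*"
    and sub: "S \<subseteq> R" "R \<subseteq> A \<times> A"
    and Q: "Q \<subseteq> map_prod r r ` R" "map_prod r r ` R \<subseteq> Q \<union> map_prod r r ` S"
    and xy: "x \<in> A" "y \<in> A"
  shows "(r x, r y) \<in> (Q \<union> Q\<inverse>)\<^sup>* \<longleftrightarrow> (x, y) \<in> (R \<union> R\<inverse>)\<^sup>*"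
proof
  have R_r: "(x, y) \<in> (R \<union> R\<inverse>)\<^sup>*" if "x \<in> A" "y \<in> A" "r x = r y" for x y
    using that r rtrancl_mono[of "S \<union> S\<inverse>" "R \<union> R\<inverse>"] sub(1) by blast
  have "\<forall>y\<in>A. w = r y \<longrightarrow> (x, y) \<in> (R \<union> R\<inverse>)\<^sup>*" if "(r x, w) \<in> (Q \<union> Q\<inverse>)\<^sup>*" for w
    using that
  proof induction
    case base
    then show ?case using R_r xy(1) by auto
  next
    case (step v w)
    from step(2) obtain a b where ab: "(a, b) \<in> R \<union> R\<inverse>" "v = r a" "w = r b"
      using Q(1) by fastforce
    then have "a \<in> A" "b \<in> A" using sub by auto
    have "(x, a) \<in> (R \<union> R\<inverse>)\<^sup>*"
      using step.IH ab(2) \<open>a \<in> A\<close> by blast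
    then have "(x, b) \<in> (R \<union> R\<inverse>)\<^sup>*"
      using ab(1) by (rule rtrancl.rtrancl_into_rtrancl)
    with R_r[OF \<open>b \<in> A\<close>] ab(3) show ?case
      by (meson rtrancl_trans)
  qed
  then show "(x, y) \<in> (R \<union> R\<inverse>)\<^sup>*" if "(r x, r y) \<in> (Q \<union> Q\<inverse>)\<^sup>*"
    using that xy(2) by blast
next
  assume "(x, y) \<in> (R \<union> R\<inverse>)\<^sup>*"
  then show "(r x, r y) \<in> (Q \<union> Q\<inverse>)\<^sup>*"
  proof induction
    case (step a b)
    have S_r: "r a = r b" if "(a, b) \<in> S" for a b
      using r[of a b] that sub by auto
    have Q_r: "r a = r b \<or> (r a, r b) \<in> Q" if ab: "(a, b) \<in> R" for a b
    proof -
      have "(r a, r b) \<in> map_prod r r ` R" using ab by force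
      then show ?thesis using Q(2) S_r by auto
    qed
    from step(2) Q_r[of a b] Q_r[of b a] have "r a = r b \<or> (r a, r b) \<in> Q \<union> Q\<inverse>" by auto
    with step.IH show ?case by (metis rtrancl.rtrancl_into_rtrancl)
  qed auto
qed

lemma card_components_erases:
  assumes "erases S D D'" and "well_formed D" and "S \<subseteq> crossings D"
  shows "card (components D') = card (components D)"
proof -
  let ?R = "strands (crossings D)"
  from assms(1) obtain r where r: "semiarcs D' = r ` semiarcs D"
    "crossings D' = map_crossing r ` (crossings D - S)"
    "\<And>x y. x \<in> semiarcs D \<Longrightarrow> y \<in> semiarcs D \<Longrightarrow>
       r x = r y \<longleftrightarrow> (x, y) \<in> (strands S \<union> (strands S)\<inverse>)\<^sup>*"
    unfolding erases_def by (elim exE conjE) (rule that, assumption, assumption, simp)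
  let ?Q = "strands (crossings D')"
  have Q: "?Q = map_prod r r ` strands (crossings D - S)"
    by (simp add: r(2) strands_map_crossing)
  have "(r x, r y) \<in> (?Q \<union> ?Q\<inverse>)\<^sup>* \<longleftrightarrow> (x, y) \<in> (?R \<union> ?R\<inverse>)\<^sup>*"
    if "x \<in> semiarcs D" "y \<in> semiarcs D" for x y
  proof (rule erases_connected_iff[OF r(3) _ well_formed_strands_subset[OF assms(2)] _ _ that])
    show "strands S \<subseteq> ?R" using assms(3) by (auto simp: strands_def)
    show "?Q \<subseteq> map_prod r r ` ?R"
      unfolding Q by (intro image_mono) (auto simp: strands_def)
    have "?R \<subseteq> strands (crossings D - S) \<union> strands S" by (auto simp: strands_def)
    then show "map_prod r r ` ?R \<subseteq> ?Q \<union> map_prod r r ` strands S"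
      unfolding Q by blast
  qed
  then show ?thesis
    unfolding components_def classes_eq_image r(1) image_image
    by (intro card_image_eq_if_same_kernel) (simp add: class_eq_iff)
qed

lemma card_components_reidemeister:
  assumes "reidemeister D D'" and "well_formed D"
  shows "card (components D') = card (components D)"
  using assms(1)
proof cases
  case relabel
  then show ?thesis using card_components_erases assms(2) by blast
next
  case (R1 c)
  then show ?thesis using card_components_erases[OF R1(3) assms(2)] by simp
next
  case (R2 c1 c2 x y)
  then show ?thesis using card_components_erases[OF R2(6) assms(2)] by simp
next
  case (R3 c1 c2 c3 x y z s t u)
  \<comment> \<open>the third move pairs the same six strands in a different way\<close>
  then have "strands (crossings D') = strands (crossings D)"
    by (auto simp: strands_def)
  with R3 show ?thesis by (simp add: components_def)
qed

lemma link_equiv_classical: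
  assumes "link_equiv D D'"
  shows "D = D' \<or> (classical_diagram D \<and> classical_diagram D')"
  using assms unfolding link_equiv_def
  by (induction rule: equivclp_induct) auto

lemma card_components_link_equiv:
  assumes "link_equiv D D'"
  shows "card (components D') = card (components D)"
  using assms unfolding link_equiv_def
proof (induction rule: equivclp_induct)
  case (step D1 D2)
  then show ?case
    using card_components_reidemeister by (auto simp: classical_diagram_def)
qed simp


section \<open>Components of links of given bridge index and of chain links\<close>

text \<open>
  A component either contains the start of a bridge, and different components contain different
  ones, or is counted as a bridge by itself.
\<close>

lemma card_components_le_bridge_number:
  assumes "well_formed D"
  shows "card (components D) \<le> bridge_number D"
proof -
  let ?B = "bridge_starts D"
  let ?cl = "\<lambda>x. (strands (crossings D) \<union> (strands (crossings D))\<inverse>)\<^sup>* `` {x}"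
  have fin: "finite (semiarcs D)" "finite (crossings D)"
    using assms by (auto simp: well_formed_def)
  then have finB: "finite ?B" by (simp add: bridge_starts_def)
  have "{K \<in> components D. K \<inter> ?B \<noteq> {}} \<subseteq> ?cl ` ?B"
    by (auto simp: components_def classes_eq_image class_eq_iff)
  then have le: "card {K \<in> components D. K \<inter> ?B \<noteq> {}} \<le> card ?B"
    by (rule surj_card_le[OF finB])
  have "components D = {K \<in> components D. K \<inter> ?B \<noteq> {}} \<union> {K \<in> components D. K \<inter> ?B = {}}"
    by auto
  then have "card (components D) \<le> card {K \<in> components D. K \<inter> ?B \<noteq> {}}
      + card {K \<in> components D. K \<inter> ?B = {}}"
    using card_Un_le[of "{K \<in> components D. K \<inter> ?B \<noteq> {}}" "{K \<in> components D. K \<inter> ?B = {}}"]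
    by simp
  with le show ?thesis by (simp add: bridge_number_def)
qed

lemma card_components_le_bridge_index:
  assumes "L \<in> oriented_classical_links" and "D \<in> L"
  shows "card (components D) \<le> bridge_index L"
proof -
  obtain D0 where D0: "L = link_of D0" "classical_diagram D0"
    using assms(1) by (auto simp: oriented_classical_links_def)
  have "\<exists>D1\<in>L. bridge_number D1 = bridge_index L"
    unfolding bridge_index_def
    by (rule LeastI_ex[of "\<lambda>n. \<exists>D\<in>L. bridge_number D = n"]) (use assms(2) in blast)
  then obtain D1 where D1: "D1 \<in> L" "bridge_number D1 = bridge_index L" by blast
  have equivs: "link_equiv D0 D" "link_equiv D0 D1"
    using assms(2) D1(1) D0(1) by (auto simp: link_of_def)
  then have "well_formed D1"
    using link_equiv_classical D0(2) by (auto simp: classical_diagram_def)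
  then have "card (components D1) \<le> bridge_index L"
    using card_components_le_bridge_number D1(2) by metis
  then show ?thesis
    using equivs card_components_link_equiv by metis
qed

text \<open>
  The quotient of a semiarc of the chain diagram by 4 is the number of its circle.  Being constant
  along strands, it separates the components, each of which is one circle.
\<close>

lemma chain_strand_div:
  assumes "(x, y) = chain_strand ort k i j" and "i < 4" and "j < 4"
  shows "x div 4 = k" and "y div 4 = k"
  using assms by (auto simp: chain_strand_def split: if_splits)

lemma chain_diagram_strands:
  assumes "(x, y) \<in> strands (crossings (chain_diagram N ccw ort))"
  obtains k where "k < N" and "x div 4 = k" and "y div 4 = k"
proof -
  obtain k where k: "k < N"
    "(x, y) \<in> {chain_strand ort (Suc k mod N) 3 0, chain_strand ort k 0 1,
      chain_strand ort k 1 2, chain_strand ort (Suc k mod N) 2 3}"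
    using assms
    by (auto simp: strands_def chain_diagram_def outer_crossing_def inner_crossing_def)
  then have "Suc k mod N < N" by simp
  with k show ?thesis
    using that[of k] that[of "Suc k mod N"]
      chain_strand_div[of x y ort k] chain_strand_div[of x y ort "Suc k mod N"]
    by fastforce
qed

lemma chain_diagram_semiarcs: "semiarcs (chain_diagram N ccw ort) = {..<4 * N}"
  by (simp add: chain_diagram_def)

lemma card_components_chain_diagram:
  "N \<le> card (components (chain_diagram N ccw ort))"
proof -
  have "{..<N} \<subseteq> (\<lambda>x. x div 4) ` {..<4 * N}"
    by (intro subsetI image_eqI[of _ _ "4 * x" for x]) auto
  then have "N \<le> card ((\<lambda>x. x div 4) ` {..<4 * N})"
    by (metis card_lessThan card_mono finite_imageI finite_lessThan)
  also have "\<dots> \<le> card (components (chain_diagram N ccw ort))"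
    unfolding components_def chain_diagram_semiarcs
    by (rule card_image_le_card_classes) (auto elim: chain_diagram_strands)
  finally show ?thesis .
qed


section \<open>The universal property of a presented biquandle\<close>

definition bq_swap :: "'a biquandle \<Rightarrow> 'a \<times> 'a \<Rightarrow> 'a \<times> 'a" where
  "bq_swap Y = (\<lambda>(x, y). (ov Y y x, un Y x y))"

definition un_inv :: "'a biquandle \<Rightarrow> 'a \<Rightarrow> 'a \<Rightarrow> 'a" where
  "un_inv Y x y = inv_into (carrier Y) (\<lambda>z. un Y z y) x"

definition ov_inv :: "'a biquandle \<Rightarrow> 'a \<Rightarrow> 'a \<Rightarrow> 'a" where
  "ov_inv Y x y = inv_into (carrier Y) (\<lambda>z. ov Y z y) x"

definition bq_swap_inv :: "'a biquandle \<Rightarrow> 'a \<Rightarrow> 'a \<Rightarrow> 'a \<times> 'a" where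
  "bq_swap_inv Y x y = inv_into (carrier Y \<times> carrier Y) (bq_swap Y) (x, y)"

text \<open>
  The last four operation symbols of a word can only be interpreted in \<open>Y\<close> through the inverses
  of the bijections required of a biquandle.
\<close>

fun bq_eval :: "'a biquandle \<Rightarrow> ('g \<Rightarrow> 'a) \<Rightarrow> 'g bq_word \<Rightarrow> 'a" where
  "bq_eval Y g (Gen a) = g a"
| "bq_eval Y g (UnOp s t) = un Y (bq_eval Y g s) (bq_eval Y g t)"
| "bq_eval Y g (OvOp s t) = ov Y (bq_eval Y g s) (bq_eval Y g t)"
| "bq_eval Y g (UnInv s t) = un_inv Y (bq_eval Y g s) (bq_eval Y g t)"
| "bq_eval Y g (OvInv s t) = ov_inv Y (bq_eval Y g s) (bq_eval Y g t)"
| "bq_eval Y g (SwapL s t) = fst (bq_swap_inv Y (bq_eval Y g s) (bq_eval Y g t))"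
| "bq_eval Y g (SwapR s t) = snd (bq_swap_inv Y (bq_eval Y g s) (bq_eval Y g t))"

context
  fixes Y :: "'a biquandle"
  assumes Y: "is_biquandle Y"
begin

lemma bq_bij:
  shows "y \<in> carrier Y \<Longrightarrow> bij_betw (\<lambda>x. un Y x y) (carrier Y) (carrier Y)"
    and "y \<in> carrier Y \<Longrightarrow> bij_betw (\<lambda>x. ov Y x y) (carrier Y) (carrier Y)"
    and "bij_betw (bq_swap Y) (carrier Y \<times> carrier Y) (carrier Y \<times> carrier Y)"
  using Y by (auto simp: is_biquandle_def bq_swap_def)

lemma bq_closed:
  assumes "x \<in> carrier Y" and "y \<in> carrier Y"
  shows "un Y x y \<in> carrier Y" and "ov Y x y \<in> carrier Y"
    and "un_inv Y x y \<in> carrier Y" and "ov_inv Y x y \<in> carrier Y"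
    and "bq_swap_inv Y x y \<in> carrier Y \<times> carrier Y"
  using assms bij_betwE[OF bq_bij(1)] bij_betwE[OF bq_bij(2)]
    bij_betwE[OF bij_betw_inv_into[OF bq_bij(1)]] bij_betwE[OF bij_betw_inv_into[OF bq_bij(2)]]
    bij_betwE[OF bij_betw_inv_into[OF bq_bij(3)]]
  by (simp_all add: un_inv_def ov_inv_def bq_swap_inv_def)

lemma un_inv_eqI:
  assumes "z \<in> carrier Y" and "y \<in> carrier Y" and "un Y z y = x"
  shows "un_inv Y x y = z"
  using assms bij_betw_imp_inj_on[OF bq_bij(1)] unfolding un_inv_def
  by (intro inv_into_f_eq) auto

lemma ov_inv_eqI:
  assumes "z \<in> carrier Y" and "y \<in> carrier Y" and "ov Y z y = x"
  shows "ov_inv Y x y = z"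
  using assms bij_betw_imp_inj_on[OF bq_bij(2)] unfolding ov_inv_def
  by (intro inv_into_f_eq) auto

lemma bq_swap_inv_eqI:
  assumes "l \<in> carrier Y" and "r \<in> carrier Y" and "ov Y r l = x" and "un Y l r = y"
  shows "bq_swap_inv Y x y = (l, r)"
  using assms bij_betw_imp_inj_on[OF bq_bij(3)] unfolding bq_swap_inv_def
  by (intro inv_into_f_eq) (auto simp: bq_swap_def)

lemma un_of_un_inv:
  assumes "x \<in> carrier Y" and "y \<in> carrier Y"
  shows "un Y (un_inv Y x y) y = x"
  using bij_betw_inv_into_right[OF bq_bij(1)] assms by (simp add: un_inv_def)

lemma ov_of_ov_inv:
  assumes "x \<in> carrier Y" and "y \<in> carrier Y"
  shows "ov Y (ov_inv Y x y) y = x"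
  using bij_betw_inv_into_right[OF bq_bij(2)] assms by (simp add: ov_inv_def)

lemma bq_swap_of_inv:
  assumes "x \<in> carrier Y" and "y \<in> carrier Y"
  shows "ov Y (snd (bq_swap_inv Y x y)) (fst (bq_swap_inv Y x y)) = x"
    and "un Y (fst (bq_swap_inv Y x y)) (snd (bq_swap_inv Y x y)) = y"
proof -
  have "bq_swap Y (bq_swap_inv Y x y) = (x, y)"
    using bij_betw_inv_into_right[OF bq_bij(3)] assms by (simp add: bq_swap_inv_def)
  then show "ov Y (snd (bq_swap_inv Y x y)) (fst (bq_swap_inv Y x y)) = x"
    "un Y (fst (bq_swap_inv Y x y)) (snd (bq_swap_inv Y x y)) = y"
    by (auto simp: bq_swap_def split: prod.splits)
qed

lemma bq_eval_closed:
  assumes "g \<in> A \<rightarrow> carrier Y" and "w \<in> bq_words A"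
  shows "bq_eval Y g w \<in> carrier Y"
  using assms(2)
proof (induction w)
  case (Gen a)
  then show ?case using assms(1) by (auto simp: bq_words_def)
qed (use bq_closed(5) in \<open>auto simp: bq_words_def bq_closed mem_Times_iff\<close>)

lemma bq_eval_axioms:
  assumes g: "g \<in> A \<rightarrow> carrier Y" and ax: "(s, t) \<in> bq_axioms"
    and "s \<in> bq_words A" and "t \<in> bq_words A"
  shows "bq_eval Y g s = bq_eval Y g t"
proof -
  have cl: "bq_eval Y g w \<in> carrier Y" if "set_bq_word w \<subseteq> A" for w
    using bq_eval_closed[OF g] that by (auto simp: bq_words_def)
  have laws: "\<And>x. x \<in> carrier Y \<Longrightarrow> un Y x x = ov Y x x"
    "\<And>x y z. x \<in> carrier Y \<Longrightarrow> y \<in> carrier Y \<Longrightarrow> z \<in> carrier Y \<Longrightarrow>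
      un Y (un Y x y) (un Y z y) = un Y (un Y x z) (ov Y y z) \<and>
      ov Y (un Y x y) (un Y z y) = un Y (ov Y x z) (ov Y y z) \<and>
      ov Y (ov Y x y) (ov Y z y) = ov Y (ov Y x z) (un Y y z)"
    using Y by (auto simp: is_biquandle_def)
  show ?thesis
    using ax assms(3,4)
    by cases
      (simp_all add: bq_words_def cl laws un_of_un_inv ov_of_ov_inv bq_swap_of_inv bq_closed
        un_inv_eqI ov_inv_eqI bq_swap_inv_eqI[OF _ _ HOL.refl HOL.refl])
qed

lemma bq_eval_cong:
  assumes "(s, t) \<in> bq_cong A R" and g: "g \<in> A \<rightarrow> carrier Y"
    and R: "\<And>s t. (s, t) \<in> R \<Longrightarrow> bq_eval Y g s = bq_eval Y g t"
  shows "bq_eval Y g s = bq_eval Y g t"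
  using assms(1)
proof induction
  case (base s t)
  then show ?case using bq_eval_axioms[OF g] R by blast
qed auto

end

lemma presented_carrier:
  "carrier (presented_biquandle A R) = (\<lambda>w. bq_cong A R `` {w}) ` bq_words A"
  by (auto simp: presented_biquandle_def quotient_def)

lemma presented_class_eq_iff:
  assumes "s \<in> bq_words A" and "t \<in> bq_words A"
  shows "bq_cong A R `` {s} = bq_cong A R `` {t} \<longleftrightarrow> (s, t) \<in> bq_cong A R"
  by (rule eq_equiv_class_iff[OF bq_cong_equiv assms])

lemma presented_ops:
  assumes "s \<in> bq_words A" and "t \<in> bq_words A"
  shows "un (presented_biquandle A R) (bq_cong A R `` {s}) (bq_cong A R `` {t}) =
      bq_cong A R `` {UnOp s t}"
    and "ov (presented_biquandle A R) (bq_cong A R `` {s}) (bq_cong A R `` {t}) =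
      bq_cong A R `` {OvOp s t}"
proof -
  note E = bq_cong_equiv[of A R]
  have "congruent2 (bq_cong A R) (bq_cong A R) (\<lambda>s t. bq_cong A R `` {F s t})"
    if "F \<in> {UnOp, OvOp}" for F
    using that by (intro congruent2I' equiv_class_eq[OF E]) (auto intro: bq_cong.cong)
  from UN_equiv_class2[OF E E this assms]
  show "un (presented_biquandle A R) (bq_cong A R `` {s}) (bq_cong A R `` {t}) =
      bq_cong A R `` {UnOp s t}"
    and "ov (presented_biquandle A R) (bq_cong A R `` {s}) (bq_cong A R `` {t}) =
      bq_cong A R `` {OvOp s t}"
    by (simp_all add: presented_biquandle_def)
qed

lemma bq_words_op_iff:
  "UnOp s t \<in> bq_words A \<longleftrightarrow> s \<in> bq_words A \<and> t \<in> bq_words A"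
  "OvOp s t \<in> bq_words A \<longleftrightarrow> s \<in> bq_words A \<and> t \<in> bq_words A"
  "UnInv s t \<in> bq_words A \<longleftrightarrow> s \<in> bq_words A \<and> t \<in> bq_words A"
  "OvInv s t \<in> bq_words A \<longleftrightarrow> s \<in> bq_words A \<and> t \<in> bq_words A"
  "SwapL s t \<in> bq_words A \<longleftrightarrow> s \<in> bq_words A \<and> t \<in> bq_words A"
  "SwapR s t \<in> bq_words A \<longleftrightarrow> s \<in> bq_words A \<and> t \<in> bq_words A"
  "Gen a \<in> bq_words A \<longleftrightarrow> a \<in> A"
  by (auto simp: bq_words_def)

text \<open>
  A homomorphism is only required to respect the two operations.  It respects the four inverse
  operations too, because these are determined by equations in the two operations; hence it is
  determined by its values on the generators.
\<close>

lemma hom_eq_bq_eval: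
  assumes Y: "is_biquandle Y"
    and v: "v \<in> biquandle_hom (presented_biquandle A R) Y" and w: "w \<in> bq_words A"
  shows "v (bq_cong A R `` {w}) = bq_eval Y (\<lambda>a\<in>A. v (bq_cong A R `` {Gen a})) w"
  using w
proof (induction w)
  let ?c = "\<lambda>w. bq_cong A R `` {w}"
  have v_closed: "v (?c w) \<in> carrier Y" if "w \<in> bq_words A" for w
    using v that by (auto simp: biquandle_hom_def presented_carrier)
  have v_ops: "v (?c (UnOp s t)) = un Y (v (?c s)) (v (?c t))"
    "v (?c (OvOp s t)) = ov Y (v (?c s)) (v (?c t))"
    if "s \<in> bq_words A" "t \<in> bq_words A" for s t
    using v that by (auto simp: biquandle_hom_def presented_carrier presented_ops[symmetric])
  have c_ax: "?c s = ?c t" if "(s, t) \<in> bq_axioms" "s \<in> bq_words A" "t \<in> bq_words A" for s t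
    using that presented_class_eq_iff[of s A t R] by (auto intro: bq_cong.base)
  {
    case (Gen a)
    then show ?case by (simp add: bq_words_op_iff)
  next
    case (UnOp s t)
    then show ?case by (simp add: bq_words_op_iff v_ops)
  next
    case (OvOp s t)
    then show ?case by (simp add: bq_words_op_iff v_ops)
  next
    case (UnInv s t)
    then have "un Y (v (?c (UnInv s t))) (v (?c t)) = v (?c s)"
      using c_ax[of "UnOp (UnInv s t) t" s] v_ops(1)[of "UnInv s t" t]
      by (simp add: bq_words_op_iff bq_axioms.intros)
    with UnInv show ?case
      using un_inv_eqI[OF Y v_closed v_closed, of "UnInv s t" t] by (simp add: bq_words_op_iff)
  next
    case (OvInv s t)
    then have "ov Y (v (?c (OvInv s t))) (v (?c t)) = v (?c s)"
      using c_ax[of "OvOp (OvInv s t) t" s] v_ops(2)[of "OvInv s t" t]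
      by (simp add: bq_words_op_iff bq_axioms.intros)
    with OvInv show ?case
      using ov_inv_eqI[OF Y v_closed v_closed, of "OvInv s t" t] by (simp add: bq_words_op_iff)
  next
    case (SwapL s t)
    then have "bq_swap_inv Y (v (?c s)) (v (?c t)) = (v (?c (SwapL s t)), v (?c (SwapR s t)))"
      using c_ax[of "OvOp (SwapR s t) (SwapL s t)" s] c_ax[of "UnOp (SwapL s t) (SwapR s t)" t]
        v_ops[of "SwapR s t" "SwapL s t"] v_ops[of "SwapL s t" "SwapR s t"]
      by (intro bq_swap_inv_eqI[OF Y] v_closed) (simp_all add: bq_words_op_iff bq_axioms.intros)
    with SwapL show ?case by (simp add: bq_words_op_iff)
  next
    case (SwapR s t)
    then have "bq_swap_inv Y (v (?c s)) (v (?c t)) = (v (?c (SwapL s t)), v (?c (SwapR s t)))"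
      using c_ax[of "OvOp (SwapR s t) (SwapL s t)" s] c_ax[of "UnOp (SwapL s t) (SwapR s t)" t]
        v_ops[of "SwapR s t" "SwapL s t"] v_ops[of "SwapL s t" "SwapR s t"]
      by (intro bq_swap_inv_eqI[OF Y] v_closed) (simp_all add: bq_words_op_iff bq_axioms.intros)
    with SwapR show ?case by (simp add: bq_words_op_iff)
  }
qed

text \<open>
  Injectivity is \<open>hom_eq_bq_eval\<close>.  For surjectivity, evaluation of words along \<open>g\<close> respects the
  generating congruence, since \<open>Y\<close> satisfies the axioms and \<open>g\<close> the relations, and so descends to
  the quotient.
\<close>

theorem presented_biquandle_universal:
  assumes Y: "is_biquandle Y" and R: "R \<subseteq> bq_words A \<times> bq_words A"
  shows "bij_betw (\<lambda>v. \<lambda>a\<in>A. v (bq_cong A R `` {Gen a}))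
    (biquandle_hom (presented_biquandle A R) Y)
    {g \<in> A \<rightarrow>\<^sub>E carrier Y. \<forall>(s, t)\<in>R. bq_eval Y g s = bq_eval Y g t}"
    (is "bij_betw ?gens ?H ?G")
proof (rule bij_betw_imageI)
  let ?c = "\<lambda>w. bq_cong A R `` {w}"
  let ?X = "presented_biquandle A R"
  show "inj_on ?gens ?H"
  proof (rule inj_onI)
    fix v v' assume v: "v \<in> ?H" "v' \<in> ?H" and eq: "?gens v = ?gens v'"
    have "v P = v' P" if P: "P \<in> carrier ?X" for P
    proof -
      obtain w where "w \<in> bq_words A" "P = ?c w"
        using P unfolding presented_carrier by (rule imageE)
      then show ?thesis
        using hom_eq_bq_eval[OF Y v(1)] hom_eq_bq_eval[OF Y v(2)] eq by simp
    qed
    moreover have "v \<in> carrier ?X \<rightarrow>\<^sub>E carrier Y" "v' \<in> carrier ?X \<rightarrow>\<^sub>E carrier Y"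
      using v by (auto simp: biquandle_hom_def)
    ultimately show "v = v'" by (metis PiE_ext)
  qed
  show "?gens ` ?H = ?G"
  proof (intro equalityI subsetI)
    fix g assume "g \<in> ?gens ` ?H"
    then obtain v where v: "v \<in> ?H" "g = ?gens v" by auto
    have "bq_eval Y g s = bq_eval Y g t" if st: "(s, t) \<in> R" for s t
    proof -
      have w: "s \<in> bq_words A" "t \<in> bq_words A" using st R by auto
      then have "?c s = ?c t"
        using st presented_class_eq_iff[of s A t R] by (auto intro: bq_cong.base)
      then show ?thesis
        using hom_eq_bq_eval[OF Y v(1)] w v(2) by metis
    qed
    moreover have "g \<in> A \<rightarrow>\<^sub>E carrier Y"
      using v by (auto simp: biquandle_hom_def presented_carrier bq_words_op_iff)
    ultimately show "g \<in> ?G" by auto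
  next
    fix g assume g: "g \<in> ?G"
    then have gY: "g \<in> A \<rightarrow> carrier Y" by auto
    \<comment> \<open>the value on a class is that of any of its words\<close>
    let ?v = "\<lambda>P\<in>carrier ?X. bq_eval Y g (SOME w. w \<in> P)"
    have v: "?v (?c w) = bq_eval Y g w" if w: "w \<in> bq_words A" for w
    proof -
      have "(SOME u. u \<in> ?c w) \<in> ?c w"
        by (rule someI[of _ w]) (auto intro: bq_cong.refl w)
      then have "(w, SOME u. u \<in> ?c w) \<in> bq_cong A R" by simp
      then have "bq_eval Y g w = bq_eval Y g (SOME u. u \<in> ?c w)"
        by (rule bq_eval_cong[OF Y _ gY]) (use g in auto)
      then show ?thesis using w by (simp add: presented_carrier)
    qed
    have vH: "?v \<in> ?H"
      unfolding biquandle_hom_def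
    proof (intro CollectI conjI ballI)
      have "?v P \<in> carrier Y" if P: "P \<in> carrier ?X" for P
      proof -
        obtain w where "w \<in> bq_words A" "P = ?c w"
          using P unfolding presented_carrier by (rule imageE)
        then show ?thesis using v bq_eval_closed[OF Y gY] by simp
      qed
      then show "?v \<in> carrier ?X \<rightarrow>\<^sub>E carrier Y"
        by (auto intro!: restrict_PiE)
    next
      fix P Q assume "P \<in> carrier ?X" "Q \<in> carrier ?X"
      then obtain s t where st: "s \<in> bq_words A" "P = ?c s" "t \<in> bq_words A" "Q = ?c t"
        unfolding presented_carrier by (elim imageE)
      then show "?v (un ?X P Q) = un Y (?v P) (?v Q)" "?v (ov ?X P Q) = ov Y (?v P) (?v Q)"
        by (simp_all only: presented_ops v bq_words_op_iff simp_thms bq_eval.simps)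
    qed
    have gens: "?gens ?v = g"
    proof
      fix a
      show "?gens ?v a = g a"
      proof (cases "a \<in> A")
        case True
        then show ?thesis by (simp only: restrict_apply' v bq_words_op_iff bq_eval.simps)
      next
        case False
        with g show ?thesis by (auto simp: PiE_def extensional_def)
      qed
    qed
    from imageI[OF vH, of ?gens] show "g \<in> ?gens ` ?H" by (simp only: gens)
  qed
qed


section \<open>Colorings by the integers modulo 4\<close>

lemma phi_double: "phi x = 2 * x"
  using Z4_cases[of x] by (auto simp: phi_def)

lemma phi_eq_0_iff: "phi x = 0 \<longleftrightarrow> x \<in> {0, 2}"
  using Z4_cases[of x] by (auto simp: phi_def)

lemma Z4_hom_iff:
  assumes "is_biquandle X"
  shows "(\<lambda>P\<in>carrier X. f P) \<in> biquandle_hom X Z4_biquandle \<longleftrightarrow>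
    (\<forall>P\<in>carrier X. \<forall>Q\<in>carrier X. f (un X P Q) = f P + 2 * f Q \<and> f (ov X P Q) = 3 * f P)"
  using bq_closed(1,2)[OF assms] by (auto simp: biquandle_hom_def Z4_biquandle_def)

lemma Z4_homE:
  assumes "v \<in> biquandle_hom X Z4_biquandle"
  shows "v \<in> extensional (carrier X)"
    and "P \<in> carrier X \<Longrightarrow> Q \<in> carrier X \<Longrightarrow> v (un X P Q) = v P + 2 * v Q"
    and "P \<in> carrier X \<Longrightarrow> Q \<in> carrier X \<Longrightarrow> v (ov X P Q) = 3 * v P"
  using assms by (auto simp: biquandle_hom_def Z4_biquandle_def PiE_def)

lemma Z4_hom_zero:
  assumes "is_biquandle X"
  shows "(\<lambda>P\<in>carrier X. 0) \<in> biquandle_hom X Z4_biquandle"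
  by (simp add: Z4_hom_iff[OF assms])

lemma Z4_hom_add:
  assumes "is_biquandle X" and "u \<in> biquandle_hom X Z4_biquandle" and "v \<in> biquandle_hom X Z4_biquandle"
  shows "(\<lambda>P\<in>carrier X. u P + v P) \<in> biquandle_hom X Z4_biquandle"
  using Z4_homE[OF assms(2)] Z4_homE[OF assms(3)]
  by (simp add: Z4_hom_iff[OF assms(1)] algebra_simps)

lemma Z4_hom_diff:
  assumes "is_biquandle X" and "u \<in> biquandle_hom X Z4_biquandle" and "v \<in> biquandle_hom X Z4_biquandle"
  shows "(\<lambda>P\<in>carrier X. u P - v P) \<in> biquandle_hom X Z4_biquandle"
  using Z4_homE[OF assms(2)] Z4_homE[OF assms(3)]
  by (simp add: Z4_hom_iff[OF assms(1)] algebra_simps)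

definition doubling_fibre :: "'a biquandle \<Rightarrow> ('a \<Rightarrow> 4) \<Rightarrow> ('a \<Rightarrow> 4) set" where
  "doubling_fibre X w =
     {v \<in> biquandle_hom X Z4_biquandle. compose (carrier X) phi v = w}"

definition doubling_kernel :: "'a biquandle \<Rightarrow> ('a \<Rightarrow> 4) set" where
  "doubling_kernel X = doubling_fibre X (\<lambda>P\<in>carrier X. 0)"

text \<open>Subtraction of one coloring \<open>u\<close> of the fibre translates the fibre onto the kernel.\<close>

lemma card_doubling_fibre:
  assumes X: "is_biquandle X" and u: "u \<in> doubling_fibre X w"
  shows "card (doubling_fibre X w) = card (doubling_kernel X)"
proof -
  have uH: "u \<in> biquandle_hom X Z4_biquandle" and uw: "w = (\<lambda>P\<in>carrier X. 2 * u P)"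
    using u by (auto simp: doubling_fibre_def compose_def phi_double)
  have "bij_betw (\<lambda>v. \<lambda>P\<in>carrier X. v P - u P) (doubling_fibre X w) (doubling_kernel X)"
  proof (rule bij_betw_byWitness[where f' = "\<lambda>k. \<lambda>P\<in>carrier X. k P + u P"])
    have undef: "v P = undefined" if "v \<in> doubling_fibre X w'" "P \<notin> carrier X" for v w' P
      using that Z4_homE(1) by (auto simp: doubling_fibre_def intro: extensional_arb)
    show "\<forall>v\<in>doubling_fibre X w. (\<lambda>P\<in>carrier X. (\<lambda>P\<in>carrier X. v P - u P) P + u P) = v"
      by (auto simp: fun_eq_iff undef)
    show "\<forall>k\<in>doubling_kernel X. (\<lambda>P\<in>carrier X. (\<lambda>P\<in>carrier X. k P + u P) P - u P) = k"
      unfolding doubling_kernel_def by (auto simp: fun_eq_iff undef)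
    show "(\<lambda>v. \<lambda>P\<in>carrier X. v P - u P) ` doubling_fibre X w \<subseteq> doubling_kernel X"
    proof (intro image_subsetI)
      fix v assume v: "v \<in> doubling_fibre X w"
      then have "compose (carrier X) phi v = w" by (simp add: doubling_fibre_def)
      then have "2 * v P = 2 * u P" if "P \<in> carrier X" for P
        using that uw by (auto simp: compose_def phi_double dest!: fun_cong[of _ _ P])
      with v show "(\<lambda>P\<in>carrier X. v P - u P) \<in> doubling_kernel X"
        using Z4_hom_diff[OF X _ uH]
        by (auto simp: doubling_kernel_def doubling_fibre_def compose_def phi_double fun_eq_iff algebra_simps)
    qed
    show "(\<lambda>k. \<lambda>P\<in>carrier X. k P + u P) ` doubling_kernel X \<subseteq> doubling_fibre X w"
    proof (intro image_subsetI)
      fix k assume k: "k \<in> doubling_kernel X"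
      then have "compose (carrier X) phi k = (\<lambda>P\<in>carrier X. 0)"
        by (simp add: doubling_kernel_def doubling_fibre_def)
      then have "2 * k P = 0" if "P \<in> carrier X" for P
        using that by (auto simp: compose_def phi_double dest!: fun_cong[of _ _ P])
      with k show "(\<lambda>P\<in>carrier X. k P + u P) \<in> doubling_fibre X w"
        using Z4_hom_add[OF X _ uH]
        by (auto simp: doubling_kernel_def doubling_fibre_def compose_def phi_double fun_eq_iff uw algebra_simps)
    qed
  qed
  then show ?thesis by (rule bij_betw_same_card)
qed

text \<open>
  For even labels, adding \<open>2 * y\<close> and multiplying by 3 change nothing, so that the crossing
  relations, whatever the sign, only ask the label to persist along each strand.
\<close>

lemma crossing_relations_even:
  assumes "g a \<in> {0, 2}" "g b \<in> {0, 2}" "g c \<in> {0, 2}" "g d \<in> {0, 2}"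
  shows "(\<forall>(s, t)\<in>crossing_relations (Crossing p (a, b) (c, d)).
      bq_eval Z4_biquandle g s = bq_eval Z4_biquandle g t) \<longleftrightarrow> g a = g b \<and> g c = g d"
proof -
  have "2 * g c = 0" "2 * g d = 0" "3 * g c = g c" "3 * g d = g d"
    using assms(3,4) by auto
  then show ?thesis
    by (cases p) (auto simp: Z4_biquandle_def)
qed

lemma bij_betw_Collect_image:
  assumes "bij_betw f A B"
  shows "bij_betw f {x \<in> A. P (f x)} {y \<in> B. P y}"
  using assms by (auto simp: bij_betw_def inj_on_def)

text \<open>
  A coloring lies in the kernel iff it is even on the semiarcs: its double is again a coloring,
  and a coloring that vanishes on the semiarcs is zero.  The relations between even labels then
  leave one free choice in \<open>{0, 2}\<close> per component.
\<close>

lemma card_doubling_kernel: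
  assumes fin: "finite (semiarcs D)"
    and sub: "strands (crossings D) \<subseteq> semiarcs D \<times> semiarcs D"
  shows "card (doubling_kernel (fundamental_biquandle D)) = 2 ^ card (components D)"
proof -
  let ?A = "semiarcs D" and ?R = "\<Union>c\<in>crossings D. crossing_relations c"
  let ?X = "presented_biquandle ?A ?R"
  let ?H = "biquandle_hom ?X Z4_biquandle"
  let ?gens = "\<lambda>v. \<lambda>a\<in>?A. v (bq_cong ?A ?R `` {Gen a})"
  let ?rel = "\<lambda>g. \<forall>(s, t)\<in>?R. bq_eval Z4_biquandle g s = bq_eval Z4_biquandle g t"
  note X = presented_biquandle[of ?A ?R]
  have strand: "under c \<in> ?A \<times> ?A" "over c \<in> ?A \<times> ?A" if "c \<in> crossings D" for c
    using that sub by (auto simp: strands_def)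
  have R: "?R \<subseteq> bq_words ?A \<times> bq_words ?A"
  proof (rule UN_least)
    fix c assume "c \<in> crossings D"
    from strand[OF this] show "crossing_relations c \<subseteq> bq_words ?A \<times> bq_words ?A"
      by (cases c rule: crossing_relations.cases) (auto simp: bq_words_def)
  qed
  have bij: "bij_betw ?gens ?H {g \<in> ?A \<rightarrow>\<^sub>E UNIV. ?rel g}"
    using presented_biquandle_universal[OF Z4_biquandle R] by (simp add: Z4_biquandle_def)
  have gen: "bq_cong ?A ?R `` {Gen a} \<in> carrier ?X" if "a \<in> ?A" for a
    using that by (simp add: presented_carrier bq_words_op_iff)
  have ker: "v \<in> doubling_kernel ?X \<longleftrightarrow> (\<forall>a\<in>?A. phi (?gens v a) = 0)" if v: "v \<in> ?H" for v
  proof -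
    have double: "compose (carrier ?X) phi v = (\<lambda>P\<in>carrier ?X. v P + v P)"
      by (auto simp: compose_def phi_double)
    have "v \<in> doubling_kernel ?X \<longleftrightarrow> (\<lambda>P\<in>carrier ?X. v P + v P) = (\<lambda>P\<in>carrier ?X. 0)"
      using v by (simp add: doubling_kernel_def doubling_fibre_def double)
    also have "\<dots> \<longleftrightarrow> ?gens (\<lambda>P\<in>carrier ?X. v P + v P) = ?gens (\<lambda>P\<in>carrier ?X. 0)"
      using bij_betw_imp_inj_on[OF bij] Z4_hom_add[OF X v v] Z4_hom_zero[OF X]
      by (rule inj_on_eq_iff[symmetric])
    also have "\<dots> \<longleftrightarrow> (\<forall>a\<in>?A. phi (?gens v a) = 0)"
      using gen by (auto simp: fun_eq_iff phi_double)
    finally show ?thesis .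
  qed
  have "doubling_kernel ?X = {v \<in> ?H. \<forall>a\<in>?A. phi (?gens v a) = 0}"
    using ker by (auto simp: doubling_kernel_def doubling_fibre_def)
  then have "bij_betw ?gens (doubling_kernel ?X) {g \<in> ?A \<rightarrow>\<^sub>E UNIV. ?rel g \<and> (\<forall>a\<in>?A. phi (g a) = 0)}"
    using bij_betw_Collect_image[OF bij, of "\<lambda>g. \<forall>a\<in>?A. phi (g a) = 0"] by simp
  then have "card (doubling_kernel ?X) = card {g \<in> ?A \<rightarrow>\<^sub>E UNIV. ?rel g \<and> (\<forall>a\<in>?A. phi (g a) = 0)}"
    by (rule bij_betw_same_card)
  also have "{g \<in> ?A \<rightarrow>\<^sub>E UNIV. ?rel g \<and> (\<forall>a\<in>?A. phi (g a) = 0)} =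
      {g \<in> ?A \<rightarrow>\<^sub>E {0, 2}. ?rel g}"
    by (auto simp: phi_eq_0_iff PiE_def)
  also have "\<dots> = {g \<in> ?A \<rightarrow>\<^sub>E {0, 2}. \<forall>(a, b)\<in>strands (crossings D). g a = g b}"
  proof (rule Collect_cong, rule conj_cong[OF HOL.refl])
    fix g :: "nat \<Rightarrow> 4" assume g: "g \<in> ?A \<rightarrow>\<^sub>E {0, 2}"
    have "(\<forall>(s, t)\<in>crossing_relations c. bq_eval Z4_biquandle g s = bq_eval Z4_biquandle g t) \<longleftrightarrow>
        (\<forall>(a, b)\<in>{under c, over c}. g a = g b)" if c: "c \<in> crossings D" for c
    proof -
      obtain p x y z w where eq: "c = Crossing p (x, y) (z, w)"
        by (metis crossing.exhaust surj_pair)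
      then have "x \<in> ?A" "y \<in> ?A" "z \<in> ?A" "w \<in> ?A"
        using strand[OF c] by auto
      then have "g x \<in> {0, 2}" "g y \<in> {0, 2}" "g z \<in> {0, 2}" "g w \<in> {0, 2}"
        using g by (auto simp only: PiE_mem)
      from crossing_relations_even[of g, OF this] eq show ?thesis by simp
    qed
    then show "?rel g \<longleftrightarrow> (\<forall>(a, b)\<in>strands (crossings D). g a = g b)"
      by (simp add: strands_def ball_Un ball_conj_distrib)
  qed
  also have "card \<dots> = 2 ^ card (components D)"
    using card_functions_constant_along[OF fin sub, of "{0, 2 :: 4}"]
    by (simp add: components_def numeral_2_eq_2)
  finally show ?thesis by (simp add: fundamental_biquandle_def)
qed


section \<open>In-degrees of the coloring quiver\<close>

lemma in_degree_coloring_quiver: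
  "in_degree (coloring_quiver Z4_biquandle phi D) w =
     card (doubling_fibre (fundamental_biquandle D) w)"
  by (simp add: in_degree_def in_arcs_def coloring_quiver_def doubling_fibre_def)

text \<open>
  The zero coloring need not correspond to the zero coloring under an isomorphism.  But its image
  has the same positive in-degree, and every positive in-degree is the order of the kernel.
\<close>

lemma card_doubling_kernel_eq_if_iso:
  assumes iso: "digraph_iso (coloring_quiver Z4_biquandle phi D) (coloring_quiver Z4_biquandle phi D')"
    and pos: "card (doubling_kernel (fundamental_biquandle D)) > 0"
  shows "card (doubling_kernel (fundamental_biquandle D)) = card (doubling_kernel (fundamental_biquandle D'))"
proof -
  let ?G = "coloring_quiver Z4_biquandle phi D" and ?G' = "coloring_quiver Z4_biquandle phi D'"
  let ?X = "fundamental_biquandle D" and ?X' = "fundamental_biquandle D'"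
  have X: "is_biquandle ?X" "is_biquandle ?X'"
    by (simp_all add: fundamental_biquandle_def presented_biquandle)
  obtain f where f: "pre_digraph.digraph_isomorphism ?G f" "?G' = app_iso f ?G"
    using iso by (auto simp: digraph_iso_def)
  let ?z = "\<lambda>P\<in>carrier ?X. 0 :: 4"
  have "wf_digraph ?G"
    using f(1) by (simp add: pre_digraph.digraph_isomorphism_def)
  moreover have "?z \<in> verts ?G"
    using Z4_hom_zero[OF X(1)] by (simp add: coloring_quiver_def)
  ultimately have "in_degree ?G' (iso_verts f ?z) = in_degree ?G ?z"
    using f wf_digraph.in_degree_app_iso_eq by metis
  then have eq: "card (doubling_fibre ?X' (iso_verts f ?z)) = card (doubling_kernel ?X)"
    by (simp add: in_degree_coloring_quiver doubling_kernel_def)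
  with pos obtain u where "u \<in> doubling_fibre ?X' (iso_verts f ?z)"
    by (metis card.empty all_not_in_conv less_irrefl)
  with eq show ?thesis
    using card_doubling_fibre[OF X(2)] by metis
qed

theorem theorem4p1:
  fixes b :: nat and L :: "diagram set" and D D' :: diagram
    and ccw :: bool and ort :: "nat \<Rightarrow> bool"
  assumes "b > 1"
    and "L \<in> oriented_classical_links"
    and "bridge_index L = b"
    and "D \<in> L"
    and "card (biquandle_hom (fundamental_biquandle D) Z4_biquandle) = 4 ^ b"
    and "D' \<in> chain_link (2 * b - 1) ccw ort"
  shows "\<not> digraph_iso (coloring_quiver Z4_biquandle phi D) (coloring_quiver Z4_biquandle phi D')"
proof
  let ?C = "chain_diagram (2 * b - 1) ccw ort"
  assume iso: "digraph_iso (coloring_quiver Z4_biquandle phi D) (coloring_quiver Z4_biquandle phi D')"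
  obtain D0 where "classical_diagram D0" "link_equiv D0 D"
    using assms(2,4) by (auto simp: oriented_classical_links_def link_of_def)
  then have "well_formed D"
    using link_equiv_classical by (auto simp: classical_diagram_def)
  then have D: "card (doubling_kernel (fundamental_biquandle D)) = 2 ^ card (components D)"
    using card_doubling_kernel well_formed_strands_subset by (auto simp: well_formed_def)
  have C: "link_equiv ?C D'"
    using assms(6) by (simp add: chain_link_def link_of_def)
  have "finite (semiarcs D') \<and> strands (crossings D') \<subseteq> semiarcs D' \<times> semiarcs D'"
    using link_equiv_classical[OF C]
  proof
    assume eq: "?C = D'"
    have "strands (crossings ?C) \<subseteq> semiarcs ?C \<times> semiarcs ?C"
      by (auto simp: chain_diagram_semiarcs elim!: chain_diagram_strands)
    with eq show ?thesis by (metis chain_diagram_semiarcs finite_lessThan)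
  next
    assume "classical_diagram ?C \<and> classical_diagram D'"
    then have "well_formed D'" by (simp add: classical_diagram_def)
    then show ?thesis using well_formed_strands_subset by (simp add: well_formed_def)
  qed
  then have D': "card (doubling_kernel (fundamental_biquandle D')) = 2 ^ card (components D')"
    using card_doubling_kernel by blast
  from card_doubling_kernel_eq_if_iso[OF iso] have "card (components D) = card (components D')"
    by (simp add: D D')
  moreover have "card (components D) \<le> b"
    using card_components_le_bridge_index assms(2-4) by metis
  moreover have "2 * b - 1 \<le> card (components D')"
    using card_components_chain_diagram card_components_link_equiv[OF C] by metis
  ultimately show False using assms(1) by linarith
qed

end
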